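(* Let $Q=\prod_{j=1}^n(a_j,b_j)\subset\mathbb R^n$ be an open box with $a_j<b_j$, let $p=(p_1,\ldots,p_n)\in Q$, and let $F:\mathbb D\to Q$ be harmonic with $F(0)=p$. Then $$\|dF_0\|\le M_Q(p):=\left(\sum_{j=1}^n A_j(p_j)^2\right)^{1/2},\qquad A_j(p_j)=\frac{2(b_j-a_j)}{\pi}\sin\frac{\pi(p_j-a_j)}{b_j-a_j}.$$ The estimate is sharp for every $p\in Q$, that is, the supremum of $\|dF_0\|$ over all harmonic $F:\mathbb D\to Q$ with $F(0)=p$ equals $M_Q(p)$.
   Context: $\mathbb D=\{z\in\mathbb C:|z|<1\}$. A map $F=(f_1,\ldots,f_n):\mathbb D\to\mathbb R^n$ is harmonic if each $f_j$ is harmonic. $dF_0:\mathbb R^2\to\mathbb R^n$ is the real differential at the origin and $\|dF_0\|$ its operator norm with respect to the Euclidean norms. *)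

theory Defs
  imports "HOL-Analysis.Analysis"
begin

text \<open>
  Twice continuously (real) differentiable with vanishing Laplacian. Here \<open>f''\<close> is the
  second derivative as a bounded bilinear form, so \<open>f'' z e e\<close> is the second partial derivative
  in direction \<open>e\<close>. On \<^typ>\<open>complex\<close> the basis is \<open>{1, \<i>}\<close>.
\<close>

definition harmonic_on :: "('a::euclidean_space \<Rightarrow> real) \<Rightarrow> 'a set \<Rightarrow> bool" where
  "harmonic_on f S \<longleftrightarrow> open S \<and>
     (\<exists>(f' :: 'a \<Rightarrow> 'a \<Rightarrow>\<^sub>L real) (f'' :: 'a \<Rightarrow> 'a \<Rightarrow>\<^sub>L 'a \<Rightarrow>\<^sub>L real).
        (\<forall>z\<in>S. (f has_derivative blinfun_apply (f' z)) (at z)) \<and>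
        (\<forall>z\<in>S. (f' has_derivative blinfun_apply (f'' z)) (at z)) \<and>
        continuous_on S f'' \<and>
        (\<forall>z\<in>S. (\<Sum>e\<in>Basis. blinfun_apply (blinfun_apply (f'' z) e) e) = 0))"

definition harmonic_map_on :: "('a::euclidean_space \<Rightarrow> real ^ 'n) \<Rightarrow> 'a set \<Rightarrow> bool" where
  "harmonic_map_on F S \<longleftrightarrow> (\<forall>j. harmonic_on (\<lambda>z. F z $ j) S)"

definition A_coef :: "real \<Rightarrow> real \<Rightarrow> real \<Rightarrow> real" where
  "A_coef a b t = 2 * (b - a) / pi * sin (pi * (t - a) / (b - a))"

definition M_box :: "real ^ 'n \<Rightarrow> real ^ 'n \<Rightarrow> real ^ 'n \<Rightarrow> real" where
  "M_box a b p = sqrt (\<Sum>j\<in>UNIV. (A_coef (a $ j) (b $ j) (p $ j))\<^sup>2)"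

text \<open>
  The harmonic maps from the unit disc into the open box with corners \<open>a\<close> and \<open>b\<close> that send
  \<open>0\<close> to \<open>p\<close>. Functions are total, so the values off the disc are irrelevant.
\<close>

definition disc_box_maps :: "real ^ 'n \<Rightarrow> real ^ 'n \<Rightarrow> real ^ 'n \<Rightarrow> (complex \<Rightarrow> real ^ 'n) set" where
  "disc_box_maps a b p =
     {F. harmonic_map_on F (ball 0 1) \<and> F ` ball 0 1 \<subseteq> box a b \<and> F 0 = p}"

end

theory Submission
  imports Defs "HOL-Complex_Analysis.Conformal_Mappings"
begin

text \<open>
  A component of a harmonic map into a box is the real part of a holomorphic function with values
  in a vertical strip. The exponential maps the strip to the upper half-plane and a Cayley transform
  maps that to the disc, so the Schwarz lemma bounds the gradient of each component at the origin by
  \<open>A_coef\<close>; summing squares bounds the operator norm. Equality is attained when every component is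
  the real part of the conformal map from the disc to its strip, all normalised to have a positive
  derivative at \<open>0\<close>: the gradients are then parallel, and the direction \<open>1\<close> realises the bound.
\<close>

section \<open>Symmetry of the second derivative\<close>

text \<open>The mean value theorem along \<open>u\<close>, applied to the increment of
  \<open>f\<close> along \<open>v\<close>, identifies the leading term of the second difference as
  \<open>D v u\<close>. The second difference itself is symmetric in \<open>u\<close> and
  \<open>v\<close>, which is how symmetry of \<open>D\<close> will follow.\<close>

lemma second_difference_approx:
  fixes f :: "'a::real_normed_vector \<Rightarrow> real"
    and f' :: "'a \<Rightarrow> 'a \<Rightarrow>\<^sub>L real" and D :: "'a \<Rightarrow>\<^sub>L 'a \<Rightarrow>\<^sub>L real"
  assumes S: "open S" "x \<in> S"
    and f': "\<And>z. z \<in> S \<Longrightarrow> (f has_derivative blinfun_apply (f' z)) (at z)"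
    and D: "(f' has_derivative blinfun_apply D) (at x)"
    and e: "e > 0"
  shows "\<forall>\<^sub>F t in at_right 0.
    \<bar>f (x + t *\<^sub>R u + t *\<^sub>R v) - f (x + t *\<^sub>R u) - f (x + t *\<^sub>R v) + f x - t\<^sup>2 * D v u\<bar> \<le> e * t\<^sup>2"
proof -
  define K where "K = norm u + norm v"
  \<comment> \<open>Chosen so that the final error \<open>2 * c * K * norm u * t\<^sup>2\<close> is
    at most \<open>e * t\<^sup>2\<close>; the \<open>+ 1\<close> keeps the denominator positive when
    \<open>u = 0\<close>.\<close>
  define c where "c = e / (2 * K * norm u + 1)"
  have K: "K \<ge> 0" "norm u \<le> K" by (auto simp: K_def)
  have den: "2 * K * norm u + 1 > 0" using K by (simp add: add_nonneg_pos)
  have c: "c > 0" using e den by (simp add: c_def)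
  have cK: "c * (2 * K * norm u) \<le> e"
    using e den by (simp add: c_def field_simps)
  obtain d1 where d1: "d1 > 0" "ball x d1 \<subseteq> S"
    using S openE by blast
  obtain d2 where d2: "d2 > 0"
    "\<And>y. norm (y - x) < d2 \<Longrightarrow> norm (f' y - f' x - D (y - x)) \<le> c * norm (y - x)"
    using D c unfolding has_derivative_at_alt by blast
  define d where "d = min d1 d2 / (K + 1)"
  have d: "d > 0" using d1 d2 K by (simp add: d_def)
  have "\<forall>\<^sub>F t in at_right (0::real). t \<in> {0<..<d}"
    using d by (rule eventually_at_right_real)
  then show ?thesis
  proof eventually_elim
    case (elim t)
    then have t: "0 < t" "t < d" by auto
    have near: "norm (s *\<^sub>R u + r *\<^sub>R v) < min d1 d2 \<and> norm (s *\<^sub>R u + r *\<^sub>R v) \<le> t * K"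
      if "0 \<le> s" "s \<le> t" "0 \<le> r" "r \<le> t" for s r
    proof -
      have "norm (s *\<^sub>R u + r *\<^sub>R v) \<le> s * norm u + r * norm v"
        using that norm_triangle_ineq[of "s *\<^sub>R u" "r *\<^sub>R v"] by simp
      also have "\<dots> \<le> t * norm u + t * norm v"
        using that by (intro add_mono mult_right_mono) auto
      finally have 1: "norm (s *\<^sub>R u + r *\<^sub>R v) \<le> t * K" by (simp add: K_def distrib_left)
      have "t * K \<le> t * (K + 1)" using t by simp
      also have "\<dots> < min d1 d2" using t K by (simp add: d_def pos_less_divide_eq)
      finally show ?thesis using 1 by linarith
    qed
    have inS: "x + s *\<^sub>R u + r *\<^sub>R v \<in> S" if "0 \<le> s" "s \<le> t" "0 \<le> r" "r \<le> t" for s r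
      using near[OF that] d1(2) by (auto simp: dist_norm subset_iff norm_minus_commute add.assoc)
    have approx: "norm (f' (x + s *\<^sub>R u + r *\<^sub>R v) - f' x - D (s *\<^sub>R u + r *\<^sub>R v)) \<le> c * (t * K)"
      if "0 \<le> s" "s \<le> t" "0 \<le> r" "r \<le> t" for s r
    proof -
      have "norm (f' (x + s *\<^sub>R u + r *\<^sub>R v) - f' x - D (s *\<^sub>R u + r *\<^sub>R v)) \<le> c * norm (s *\<^sub>R u + r *\<^sub>R v)"
        using d2(2)[of "x + s *\<^sub>R u + r *\<^sub>R v"] near[OF that] by (simp add: add.assoc)
      also have "\<dots> \<le> c * (t * K)" using near[OF that] c by simp
      finally show ?thesis .
    qed
    \<comment> \<open>The second difference is \<open>g t - g 0\<close>, hence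
      \<open>t * g' s\<close> for some intermediate \<open>s\<close>.\<close>
    define g where "g s = f (x + s *\<^sub>R u + t *\<^sub>R v) - f (x + s *\<^sub>R u)" for s
    define g' where "g' s = f' (x + s *\<^sub>R u + t *\<^sub>R v) u - f' (x + s *\<^sub>R u) u" for s
    have dg: "(g has_derivative (\<lambda>h. h * g' s)) (at s)" if "0 \<le> s" "s \<le> t" for s
    proof -
      have "x + s *\<^sub>R u + t *\<^sub>R v \<in> S" "x + s *\<^sub>R u \<in> S"
        using inS[of s t] inS[of s 0] that t by auto
      note * = has_derivative_compose[where g = f and x = s and s = UNIV
            and f = "\<lambda>s. x + s *\<^sub>R u + t *\<^sub>R v", OF _ f'[OF this(1)]]
          has_derivative_compose[where g = f and x = s and s = UNIV
            and f = "\<lambda>s. x + s *\<^sub>R u", OF _ f'[OF this(2)]]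
      have "(g has_derivative (\<lambda>h. f' (x + s *\<^sub>R u + t *\<^sub>R v) (h *\<^sub>R u) - f' (x + s *\<^sub>R u) (h *\<^sub>R u))) (at s)"
        unfolding g_def
        by (intro has_derivative_diff *) (auto intro!: derivative_eq_intros)
      then show ?thesis
        by (simp add: g'_def blinfun.scaleR_right right_diff_distrib)
    qed
    obtain s where s: "0 < s" "s < t" "g t - g 0 = t * g' s"
      using mvt_simple[of 0 t g "\<lambda>s h. h * g' s"] has_derivative_at_withinI[OF dg] t by auto
    have "\<bar>g' s - t * D v u\<bar> \<le> 2 * (c * (t * K)) * norm u"
    proof -
      \<comment> \<open>The linear parts of \<open>?A\<close> and \<open>?B\<close> differ by
        \<open>t *\<^sub>R D v\<close>, so only these two first-order errors of \<open>f'\<close>,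
        each at most \<open>c * (t * K)\<close>, remain.\<close>
      let ?A = "f' (x + s *\<^sub>R u + t *\<^sub>R v) - f' x - D (s *\<^sub>R u + t *\<^sub>R v)"
      let ?B = "f' (x + s *\<^sub>R u) - f' x - D (s *\<^sub>R u)"
      have "g' s - t * D v u = (?A - ?B) u"
        by (simp add: g'_def blinfun.bilinear_simps)
      also have "\<bar>\<dots>\<bar> \<le> norm (?A - ?B) * norm u"
        using norm_blinfun[of "?A - ?B" u] by simp
      also have "\<dots> \<le> (norm ?A + norm ?B) * norm u"
        by (intro mult_right_mono norm_triangle_ineq4) auto
      also have "\<dots> \<le> (c * (t * K) + c * (t * K)) * norm u"
        using approx[of s t] approx[of s 0] s t by (intro mult_right_mono add_mono) auto
      finally show ?thesis by (simp add: mult_ac)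
    qed
    then have "t * \<bar>g' s - t * D v u\<bar> \<le> t * (2 * (c * (t * K)) * norm u)"
      using t by (intro mult_left_mono) auto
    also have "\<dots> = (c * (2 * K * norm u)) * t\<^sup>2" by (simp add: power2_eq_square)
    also have "\<dots> \<le> e * t\<^sup>2" using cK by (intro mult_right_mono) auto
    finally have "t * \<bar>g' s - t * D v u\<bar> \<le> e * t\<^sup>2" .
    moreover have "f (x + t *\<^sub>R u + t *\<^sub>R v) - f (x + t *\<^sub>R u) - f (x + t *\<^sub>R v) + f x - t\<^sup>2 * D v u
      = t * (g' s - t * D v u)"
      using s(3) by (simp add: g_def algebra_simps power2_eq_square)
    ultimately show ?case using t by (simp add: abs_mult)
  qed
qed

text \<open>Exchanging \<open>u\<close> and \<open>v\<close> fixes the second difference but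
  replaces its approximation \<open>t\<^sup>2 * D v u\<close> by \<open>t\<^sup>2 * D u v\<close>;
  dividing by \<open>t\<^sup>2\<close> leaves a gap below every positive \<open>e\<close>.\<close>

lemma second_derivative_symmetric:
  fixes f :: "'a::real_normed_vector \<Rightarrow> real"
    and f' :: "'a \<Rightarrow> 'a \<Rightarrow>\<^sub>L real" and D :: "'a \<Rightarrow>\<^sub>L 'a \<Rightarrow>\<^sub>L real"
  assumes "open S" "x \<in> S"
    and "\<And>z. z \<in> S \<Longrightarrow> (f has_derivative blinfun_apply (f' z)) (at z)"
    and "(f' has_derivative blinfun_apply D) (at x)"
  shows "D u v = D v u"
proof -
  have "\<bar>D u v - D v u\<bar> \<le> e" if "e > 0" for e
  proof -
    have "e / 2 > 0" using that by simp
    have *: "\<forall>\<^sub>F t in at_right 0.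
      \<bar>f (x + t *\<^sub>R u + t *\<^sub>R v) - f (x + t *\<^sub>R u) - f (x + t *\<^sub>R v) + f x - t\<^sup>2 * D v u\<bar> \<le> e / 2 * t\<^sup>2"
      for u v
      by (rule second_difference_approx[of S x f f' D]) (use assms \<open>e / 2 > 0\<close> in auto)
    have "\<forall>\<^sub>F t in at_right (0::real). t \<in> {0<..<1}"
      by (rule eventually_at_right_real) simp
    then have "\<forall>\<^sub>F t in at_right (0::real). \<bar>D u v - D v u\<bar> \<le> e"
      using *[of u v] *[of v u]
    proof eventually_elim
      case (elim t)
      have "\<bar>t\<^sup>2 * D u v - t\<^sup>2 * D v u\<bar> \<le> e * t\<^sup>2"
      proof -
        have "f (x + t *\<^sub>R v + t *\<^sub>R u) = f (x + t *\<^sub>R u + t *\<^sub>R v)" by (simp add: add_ac)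
        then show ?thesis using elim(2,3) by linarith
      qed
      moreover have "\<bar>t\<^sup>2 * D u v - t\<^sup>2 * D v u\<bar> = t\<^sup>2 * \<bar>D u v - D v u\<bar>"
        by (simp add: abs_mult flip: right_diff_distrib)
      ultimately have "t\<^sup>2 * \<bar>D u v - D v u\<bar> \<le> t\<^sup>2 * e"
        by (simp add: mult.commute)
      then show ?case using elim(1) by simp
    qed
    then show ?thesis by simp
  qed
  then have "\<bar>D u v - D v u\<bar> \<le> 0" by (rule field_le_epsilon) simp
  then show ?thesis by simp
qed

section \<open>Harmonic functions as real parts of holomorphic functions\<close>

text \<open>The function \<open>h\<close>, which is the partial derivative along \<open>1\<close>
  minus \<open>\<i>\<close> times the one along \<open>\<i>\<close>, is holomorphic and has a
  primitive on the convex set \<open>S\<close>. The real part of the primitive has the same gradient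
  as \<open>f\<close>, so the two differ by a constant.\<close>

lemma harmonic_on_imp_Re_holomorphic:
  fixes f :: "complex \<Rightarrow> real"
  assumes f: "harmonic_on f S" and S: "convex S"
  obtains g where "g holomorphic_on S" "\<And>z. z \<in> S \<Longrightarrow> f z = Re (g z)"
proof (cases "S = {}")
  case True
  then show ?thesis using that[of "\<lambda>_. 0"] by simp
next
  case False
  then obtain x0 where x0: "x0 \<in> S" by blast
  from f obtain f' :: "complex \<Rightarrow> complex \<Rightarrow>\<^sub>L real" and f'' :: "complex \<Rightarrow> complex \<Rightarrow>\<^sub>L complex \<Rightarrow>\<^sub>L real"
    where op: "open S"
    and f': "\<And>z. z \<in> S \<Longrightarrow> (f has_derivative f' z) (at z)"
    and f'': "\<And>z. z \<in> S \<Longrightarrow> (f' has_derivative f'' z) (at z)"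
    and lap0: "\<And>z. z \<in> S \<Longrightarrow> (\<Sum>e\<in>Basis. f'' z e e) = 0"
    unfolding harmonic_on_def by blast
  have lap: "f'' z 1 1 + f'' z \<i> \<i> = 0" if "z \<in> S" for z
    using lap0[OF that] by (simp add: Basis_complex_def)
  have expand: "L w = Re w *\<^sub>R L 1 + Im w *\<^sub>R L \<i>" for L :: "complex \<Rightarrow>\<^sub>L 'b::real_normed_vector" and w
  proof -
    have "w = Re w *\<^sub>R 1 + Im w *\<^sub>R \<i>" by (simp add: complex_eq_iff)
    then show ?thesis by (metis blinfun.add_right blinfun.scaleR_right)
  qed
  define h where "h z = Complex (f' z 1) (- f' z \<i>)" for z
  have dh: "(h has_field_derivative Complex (f'' z 1 1) (- f'' z 1 \<i>)) (at z)" if z: "z \<in> S" for z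
  proof -
    have sym: "f'' z \<i> 1 = f'' z 1 \<i>"
      using second_derivative_symmetric[OF op z f' f''] z by blast
    have "((\<lambda>z. complex_of_real (f' z 1) - \<i> * complex_of_real (f' z \<i>)) has_derivative
        (\<lambda>w. complex_of_real (f'' z w 1) - \<i> * complex_of_real (f'' z w \<i>))) (at z)"
      by (rule derivative_eq_intros f''[OF z] refl | simp add: blinfun.bilinear_simps)+
    moreover have "(\<lambda>z. complex_of_real (f' z 1) - \<i> * complex_of_real (f' z \<i>)) = h"
      by (auto simp: h_def complex_eq_iff)
    moreover have "(\<lambda>w. complex_of_real (f'' z w 1) - \<i> * complex_of_real (f'' z w \<i>))
       = (*) (Complex (f'' z 1 1) (- f'' z 1 \<i>))"
    proof
      fix w
      \<comment> \<open>Symmetry replaces \<open>f'' z \<i> 1\<close> by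
        \<open>f'' z 1 \<i>\<close>, and the Laplace equation replaces
        \<open>f'' z \<i> \<i>\<close> by \<open>- f'' z 1 1\<close>: these are the Cauchy-Riemann
        equations for \<open>h\<close>.\<close>
      have "f'' z w 1 = Re w * f'' z 1 1 + Im w * f'' z 1 \<i>"
           "f'' z w \<i> = Re w * f'' z 1 \<i> - Im w * f'' z 1 1"
        using lap[OF z] by (subst expand; simp add: blinfun.bilinear_simps sym; algebra)+
      then show "complex_of_real (f'' z w 1) - \<i> * complex_of_real (f'' z w \<i>)
         = Complex (f'' z 1 1) (- f'' z 1 \<i>) * w"
        by (simp add: complex_eq_iff algebra_simps)
    qed
    ultimately show ?thesis by (simp add: has_field_derivative_def)
  qed
  then have "h holomorphic_on S"
    using op holomorphic_on_open by blast
  then obtain g where g: "\<And>z. z \<in> S \<Longrightarrow> (g has_field_derivative h z) (at z within S)"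
    using holomorphic_convex_primitive'[OF S op] by blast
  have "((\<lambda>z. f z - Re (g z)) has_derivative (\<lambda>w. 0)) (at z within S)" if z: "z \<in> S" for z
  proof -
    have "((\<lambda>z. f z - Re (g z)) has_derivative (\<lambda>w. f' z w - Re (h z * w))) (at z within S)"
      using f'[OF z] g[OF z]
      by (intro has_derivative_diff has_derivative_Re)
         (auto simp: has_field_derivative_def intro: has_derivative_at_withinI)
    moreover have "f' z w - Re (h z * w) = 0" for w
      by (subst expand) (simp add: h_def)
    ultimately show ?thesis by simp
  qed
  then have "\<exists>c. \<forall>z\<in>S. f z - Re (g z) = c"
    by (rule has_derivative_zero_constant[OF S])
  then obtain c where c: "\<And>z. z \<in> S \<Longrightarrow> f z - Re (g z) = c"
    by blast
  show ?thesis
  proof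
    show "(\<lambda>z. g z + of_real c) holomorphic_on S"
      using g by (intro holomorphic_intros) (auto simp: holomorphic_on_def field_differentiable_def)
    show "f z = Re (g z + of_real c)" if "z \<in> S" for z
      using c[OF that] by simp
  qed
qed

text \<open>The second derivative in direction \<open>e\<close> is the real part of
  \<open>deriv (deriv g) z * e * e\<close>, and the squares of \<open>1\<close> and
  \<open>\<i>\<close> cancel in the Laplacian.\<close>

lemma harmonic_on_Re_holomorphic:
  assumes g: "g holomorphic_on S" and S: "open S"
  shows "harmonic_on (\<lambda>z. Re (g z)) S"
proof -
  \<comment> \<open>\<open>L\<close> and \<open>M\<close> turn complex multipliers into the
    operators that serve as first and second derivative. Being bounded linear, they carry
    differentiability and continuity over from the derivatives of \<open>g\<close>.\<close>
  define L :: "complex \<Rightarrow> complex \<Rightarrow>\<^sub>L real" where "L c = Blinfun Re o\<^sub>L blinfun_mult_right c" for c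
  have L [simp]: "L c w = Re (c * w)" for c w
    by (simp add: L_def bounded_linear_Blinfun_apply bounded_linear_Re)
  then have L_eq: "blinfun_apply (L c) = (\<lambda>w. Re (c * w))" for c
    by auto
  have bL: "bounded_linear L"
    unfolding L_def by (intro bounded_linear_intros)
  define M where "M c = Blinfun L o\<^sub>L blinfun_mult_right c" for c
  have M [simp]: "M c w = L (c * w)" for c w
    by (simp add: M_def bounded_linear_Blinfun_apply bL)
  then have M_eq: "blinfun_apply (M c) = (\<lambda>w. L (c * w))" for c
    by auto
  have bM: "bounded_linear M"
    unfolding M_def by (intro bounded_linear_intros)
  have g': "deriv g holomorphic_on S" and g'': "deriv (deriv g) holomorphic_on S"
    using g S by (auto intro!: holomorphic_deriv)
  show ?thesis
    unfolding harmonic_on_def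
  proof (intro conjI exI ballI)
    show "open S" by fact
  next
    fix z assume z: "z \<in> S"
    have "(g has_derivative (\<lambda>w. deriv g z * w)) (at z)"
      using holomorphic_derivI[OF g S z] by (simp add: has_field_derivative_def)
    then show "((\<lambda>z. Re (g z)) has_derivative L (deriv g z)) (at z)"
      unfolding L_eq by (rule has_derivative_Re)
    have "(deriv g has_derivative (\<lambda>w. deriv (deriv g) z * w)) (at z)"
      using holomorphic_derivI[OF g' S z] by (simp add: has_field_derivative_def)
    from bounded_linear.has_derivative[OF bL this]
    show "((\<lambda>z. L (deriv g z)) has_derivative M (deriv (deriv g) z)) (at z)"
      unfolding M_eq .
    show "(\<Sum>e\<in>Basis. M (deriv (deriv g) z) e e) = 0"
      by (simp add: Basis_complex_def)
  next
    show "continuous_on S (\<lambda>z. M (deriv (deriv g) z))"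
      using holomorphic_on_imp_continuous_on[OF g''] by (rule bounded_linear.continuous_on[OF bM])
  qed
qed

section \<open>The Schwarz lemma for a strip\<close>

text \<open>A point of the upper half-plane is closer to \<open>w\<close> than to its mirror image
  in the real axis; this puts the values of the Cayley transform inside the disc.\<close>

lemma norm_diff_less_norm_diff_cnj:
  assumes "Im z > 0" "Im w > 0"
  shows "norm (z - w) < norm (z - cnj w)"
proof -
  have "(norm (z - w))\<^sup>2 < (norm (z - cnj w))\<^sup>2"
    using mult_pos_pos[OF assms]
    unfolding cmod_power2 by (simp add: power2_eq_square algebra_simps)
  then show ?thesis by (rule power2_less_imp_less) simp
qed

lemma norm_deriv_strip_le:
  assumes g: "g holomorphic_on ball 0 1"
    and strip: "\<And>z. z \<in> ball 0 1 \<Longrightarrow> a < Re (g z) \<and> Re (g z) < b"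
  shows "norm (deriv g 0) \<le> A_coef a b (Re (g 0))"
proof -
  have ab: "a < b" using strip[of 0] by auto
  \<comment> \<open>Scales the strip to width \<open>pi\<close> and turns it by a right angle, so
    that \<open>E z\<close> has argument \<open>pi * (Re (g z) - a) / (b - a)\<close>, strictly
    between 0 and \<open>pi\<close>.\<close>
  define k where "k = \<i> * of_real (pi / (b - a))"
  define E where "E z = exp (k * (g z - of_real a))" for z
  have ImE: "Im (E z) > 0" if z: "z \<in> ball 0 1" for z
  proof -
    have "sin (pi / (b - a) * (Re (g z) - a)) > 0"
      using strip[OF z] ab by (intro sin_gt_zero) (auto simp: field_simps)
    then show ?thesis by (simp add: E_def k_def Im_exp)
  qed
  define E0 where "E0 = E 0"
  have E0: "Im E0 > 0" using ImE[of 0] by (simp add: E0_def)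
  have less: "norm (E z - E0) < norm (E z - cnj E0)" if "z \<in> ball 0 1" for z
    using norm_diff_less_norm_diff_cnj[OF ImE[OF that] E0] .
  then have nz: "E z - cnj E0 \<noteq> 0" if "z \<in> ball 0 1" for z
    using that by fastforce
  \<comment> \<open>The Cayley transform centred at \<open>E0\<close>, so that the Schwarz lemma
    applies at the origin.\<close>
  define \<phi> where "\<phi> z = (E z - E0) / (E z - cnj E0)" for z
  have "\<phi> holomorphic_on ball 0 1"
    unfolding \<phi>_def using nz unfolding E_def by (intro holomorphic_intros g) auto
  moreover have "\<phi> 0 = 0" by (simp add: \<phi>_def E0_def)
  moreover have "norm (\<phi> z) < 1" if "norm z < 1" for z
    using less[of z] nz[of z] that by (simp add: \<phi>_def norm_divide divide_less_eq)
  ultimately have le: "norm (deriv \<phi> 0) \<le> 1"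
    using Schwarz_Lemma(2)[of \<phi> 0] by simp
  have dg: "(g has_field_derivative deriv g 0) (at 0)"
    using g by (rule holomorphic_derivI) auto
  have dE: "(E has_field_derivative E0 * (k * deriv g 0)) (at 0)"
    unfolding E_def E0_def by (rule derivative_eq_intros dg refl | simp)+
  have "(\<phi> has_field_derivative (E0 * (k * deriv g 0)) / (E0 - cnj E0)) (at 0)"
    unfolding \<phi>_def using nz[of 0]
    by (auto intro!: derivative_eq_intros dE simp: E0_def[symmetric])
  then have "deriv \<phi> 0 = (E0 * (k * deriv g 0)) / (E0 - cnj E0)"
    by (rule DERIV_imp_deriv)
  \<comment> \<open>As \<open>Im E0\<close> is \<open>norm E0\<close> times the sine of its
    argument, \<open>norm E0\<close> cancels and the bound depends on \<open>Re (g 0)\<close>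
    alone.\<close>
  then have "norm E0 * (norm k * norm (deriv g 0)) \<le> norm (E0 - cnj E0)"
    using le nz[of 0] by (simp add: norm_divide norm_mult divide_le_eq E0_def)
  also have "norm (E0 - cnj E0) = 2 * Im E0"
    using E0 by (simp add: complex_diff_cnj norm_mult)
  also have "\<dots> = norm E0 * (2 * sin (pi * (Re (g 0) - a) / (b - a)))"
    by (simp add: E0_def E_def Im_exp k_def)
  finally have "norm k * norm (deriv g 0) \<le> 2 * sin (pi * (Re (g 0) - a) / (b - a))"
    using E0 by (subst (asm) mult_le_cancel_left_pos) auto
  moreover have "norm k = pi / (b - a)"
    using ab unfolding k_def norm_mult norm_of_real by simp
  ultimately show ?thesis
    using ab by (simp add: A_coef_def field_simps)
qed

lemma harmonic_strip_derivative_bound: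
  fixes f :: "complex \<Rightarrow> real"
  assumes f: "harmonic_on f (ball 0 1)"
    and strip: "\<And>z. z \<in> ball 0 1 \<Longrightarrow> a < f z \<and> f z < b"
  obtains L where "(f has_derivative L) (at 0)"
    "\<And>w. \<bar>L w\<bar> \<le> A_coef a b (f 0) * norm w"
proof -
  obtain g where g: "g holomorphic_on ball 0 1" "\<And>z. z \<in> ball 0 1 \<Longrightarrow> f z = Re (g z)"
    using harmonic_on_imp_Re_holomorphic[OF f] by auto
  have "(g has_derivative (\<lambda>w. deriv g 0 * w)) (at 0)"
    using holomorphic_derivI[OF g(1), of 0] by (simp add: has_field_derivative_def)
  then have "((\<lambda>z. Re (g z)) has_derivative (\<lambda>w. Re (deriv g 0 * w))) (at 0)"
    by (rule has_derivative_Re)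
  then have 1: "(f has_derivative (\<lambda>w. Re (deriv g 0 * w))) (at 0)"
    by (rule has_derivative_transform_within_open[of _ _ _ _ "ball 0 1"]) (auto simp: g(2))
  have "norm (deriv g 0) \<le> A_coef a b (f 0)"
    using norm_deriv_strip_le[OF g(1), of a b] strip g(2) by simp
  then have "\<bar>Re (deriv g 0 * w)\<bar> \<le> A_coef a b (f 0) * norm w" for w
    by (metis abs_Re_le_cmod mult_right_mono norm_ge_zero norm_mult order_trans)
  with 1 show ?thesis by (rule that)
qed

text \<open>
  The extremal function is the real part of the inverse of the conformal map from the strip to the
  disc used in \<open>norm_deriv_strip_le\<close>; the disc is first rotated by \<open>E0\<close> so that the derivative at the origin becomes a positive real number.
\<close>

lemma harmonic_strip_extremal:
  assumes t: "a < t" "t < b"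
  obtains f :: "complex \<Rightarrow> real" where "harmonic_on f (ball 0 1)"
    "\<And>z. z \<in> ball 0 1 \<Longrightarrow> a < f z \<and> f z < b" "f 0 = t"
    "(f has_derivative (\<lambda>w. A_coef a b t * Re w)) (at 0)"
proof -
  have ab: "a < b" using t by simp
  define \<theta> where "\<theta> = pi * (t - a) / (b - a)"
  have \<theta>: "0 < \<theta>" "\<theta> < pi" using t ab by (auto simp: \<theta>_def field_simps)
  define E0 where "E0 = cis \<theta>"
  have nE0: "E0 \<noteq> 0" "norm E0 = 1" by (auto simp: E0_def)
  have cE0: "E0 * cnj E0 = 1" by (simp add: E0_def cis_cnj cis_mult)
  \<comment> \<open>Solving \<open>(E - E0) / (E - cnj E0) = E0 * z\<close> for \<open>E\<close>,
    with \<open>E0 * cnj E0 = 1\<close>, gives this formula; the factor \<open>E0\<close> on the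
    right is the rotation.\<close>
  define E where "E z = (E0 - z) / (1 - E0 * z)" for z
  have nz: "1 - E0 * z \<noteq> 0" if "z \<in> ball 0 1" for z
  proof
    assume "1 - E0 * z = 0"
    then have "norm (E0 * z) = 1" by (metis eq_iff_diff_eq_0 norm_one)
    then show False using that nE0 by (simp add: norm_mult)
  qed
  have ImE: "Im (E z) > 0" if z: "z \<in> ball 0 1" for z
  proof -
    have s: "sin \<theta> > 0" using \<theta> by (intro sin_gt_zero)
    have z1: "(Re z)\<^sup>2 + (Im z)\<^sup>2 < 1"
      using z by (simp add: cmod_power2[symmetric] abs_square_less_1)
    \<comment> \<open>Multiplying by the conjugate denominator reduces positivity of
      \<open>Im (E z)\<close> to \<open>sin \<theta> > 0\<close> and
      \<open>norm z < 1\<close>.\<close>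
    have "E z = (E0 - z) * cnj (1 - E0 * z) / of_real ((norm (1 - E0 * z))\<^sup>2)"
      unfolding E_def by (subst complex_div_cnj) simp
    moreover have "Im ((E0 - z) * cnj (1 - E0 * z)) = sin \<theta> * (1 - ((Re z)\<^sup>2 + (Im z)\<^sup>2))"
      using sin_cos_squared_add[of \<theta>] by (simp add: E0_def power2_eq_square) algebra
    moreover have "\<dots> > 0" using s z1 by simp
    ultimately show ?thesis
      using nz[OF z] by simp
  qed
  \<comment> \<open>Inverts the exponential: the real part is \<open>a\<close> plus
    \<open>(b - a) / pi\<close> times the argument of \<open>E z\<close>.\<close>
  define g where "g z = of_real a - \<i> * of_real ((b - a) / pi) * Ln (E z)" for z
  have Eslit: "E z \<notin> \<real>\<^sub>\<le>\<^sub>0" if "z \<in> ball 0 1" for z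
    using ImE[OF that] by (auto simp: complex_nonpos_Reals_iff)
  have holE: "E holomorphic_on ball 0 1"
    unfolding E_def using nz by (intro holomorphic_intros) auto
  have holg: "g holomorphic_on ball 0 1"
    unfolding g_def using Eslit by (intro holomorphic_intros holE) auto
  have Reg: "Re (g z) = a + (b - a) / pi * Im (Ln (E z))" for z
    by (simp add: g_def)
  have E0E: "E 0 = E0" by (simp add: E_def)
  have dE: "(E has_field_derivative E0\<^sup>2 - 1) (at 0)"
    unfolding E_def by (auto intro!: derivative_eq_intros simp: power2_eq_square)
  have dg: "(g has_field_derivative - \<i> * of_real ((b - a) / pi) * ((E0\<^sup>2 - 1) / E0)) (at 0)"
  proof -
    have "(Ln has_field_derivative inverse (E 0)) (at (E 0))"
      using Eslit[of 0] by (intro has_field_derivative_Ln) auto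
    from DERIV_chain2[OF this dE]
    have "((\<lambda>z. Ln (E z)) has_field_derivative (E0\<^sup>2 - 1) / E0) (at 0)"
      by (simp add: E0E divide_inverse mult.commute)
    from DERIV_diff[OF DERIV_const[of "of_real a"] DERIV_cmult[OF this, of "\<i> * of_real ((b - a) / pi)"]]
    show ?thesis unfolding g_def[abs_def] by simp
  qed
  \<comment> \<open>This quotient is purely imaginary, so the factor \<open>- \<i>\<close> makes the
    derivative of \<open>g\<close> at 0 real, with value exactly
    \<open>A_coef a b t\<close>.\<close>
  have "(E0\<^sup>2 - 1) / E0 = E0 - cnj E0"
    using cE0 nE0 by (simp add: field_simps power2_eq_square)
  also have "\<dots> = 2 * \<i> * of_real (sin \<theta>)"
    by (simp add: complex_diff_cnj E0_def)
  finally have "- \<i> * of_real ((b - a) / pi) * ((E0\<^sup>2 - 1) / E0) = of_real (A_coef a b t)"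
    by (simp add: A_coef_def \<theta>_def algebra_simps)
  with dg have dg': "(g has_derivative (\<lambda>w. of_real (A_coef a b t) * w)) (at 0)"
    by (simp add: has_field_derivative_def)
  show ?thesis
  proof
    show "harmonic_on (\<lambda>z. Re (g z)) (ball 0 1)"
      by (rule harmonic_on_Re_holomorphic[OF holg]) simp
    show "a < Re (g z) \<and> Re (g z) < b" if "z \<in> ball 0 1" for z
    proof -
      have "0 < Im (Ln (E z)) / pi" "Im (Ln (E z)) / pi < 1"
        using Im_Ln_pos_lt_imp[OF ImE[OF that]] by auto
      then have "0 < (b - a) * (Im (Ln (E z)) / pi)" "(b - a) * (Im (Ln (E z)) / pi) < (b - a) * 1"
        by (intro mult_pos_pos mult_strict_left_mono; use ab in simp)+
      then show ?thesis by (simp add: Reg)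
    qed
    have "Ln E0 = \<i> * of_real \<theta>"
      unfolding E0_def cis_conv_exp using \<theta> by (intro Ln_exp) auto
    then show "Re (g 0) = t"
      using ab by (simp add: Reg E0E \<theta>_def)
    show "((\<lambda>z. Re (g z)) has_derivative (\<lambda>w. A_coef a b t * Re w)) (at 0)"
      using has_derivative_Re[OF dg'] by simp
  qed
qed

section \<open>Maps into a box\<close>

lemma has_derivative_vec_lambda:
  fixes F :: "'a::real_normed_vector \<Rightarrow> real ^ 'n"
  assumes "\<And>j. ((\<lambda>z. F z $ j) has_derivative L j) (at x)"
  shows "(F has_derivative (\<lambda>w. \<chi> j. L j w)) (at x)"
  unfolding has_derivative_componentwise_within[of F]
  using assms by (auto simp: Basis_vec_def inner_axis)

theorem theorem6p1:
  fixes a b p :: "real ^ 'n"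
  assumes "\<And>j. a $ j < b $ j" and "p \<in> box a b"
  shows "(\<forall>F \<in> disc_box_maps a b p. onorm (frechet_derivative F (at 0)) \<le> M_box a b p) \<and>
         (SUP F \<in> disc_box_maps a b p. onorm (frechet_derivative F (at 0))) = M_box a b p"
proof -
  let ?A = "\<lambda>j. A_coef (a $ j) (b $ j) (p $ j)"
  have p: "a $ j < p $ j" "p $ j < b $ j" for j
    using assms(2) by (auto simp: mem_box_cart)
  have M: "norm (\<chi> j. ?A j) = M_box a b p"
    by (simp add: M_box_def norm_vec_def L2_set_def)
  have upper: "onorm (frechet_derivative F (at 0)) \<le> M_box a b p" if F: "F \<in> disc_box_maps a b p" for F
  proof -
    have "\<exists>L. ((\<lambda>z. F z $ j) has_derivative L) (at 0) \<and> (\<forall>w. \<bar>L w\<bar> \<le> ?A j * norm w)" for j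
    proof -
      have "harmonic_on (\<lambda>z. F z $ j) (ball 0 1)" "F 0 = p"
        "\<And>z. z \<in> ball 0 1 \<Longrightarrow> a $ j < F z $ j \<and> F z $ j < b $ j"
        using F by (auto simp: disc_box_maps_def harmonic_map_on_def mem_box_cart image_subset_iff)
      then show ?thesis by (metis harmonic_strip_derivative_bound)
    qed
    then obtain L where L: "\<And>j. ((\<lambda>z. F z $ j) has_derivative L j) (at 0)"
      "\<And>j w. \<bar>L j w\<bar> \<le> ?A j * norm w"
      by metis
    have eq: "frechet_derivative F (at 0) = (\<lambda>w. \<chi> j. L j w)"
      using has_derivative_vec_lambda[of F L, OF L(1)] by (rule frechet_derivative_at[symmetric])
    show ?thesis
      unfolding eq
    proof (rule onorm_le)
      fix w
      \<comment> \<open>Comparing componentwise with the vector of the coefficients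
        \<open>?A j\<close>, whose norm is \<open>M_box a b p\<close>, sums the squares.\<close>
      have "norm (\<chi> j. L j w) \<le> norm (norm w *\<^sub>R (\<chi> j. ?A j))"
        using L(2) order_trans[OF L(2) abs_ge_self]
        by (intro norm_le_componentwise_cart) (simp add: mult.commute)
      then show "norm (\<chi> j. L j w) \<le> M_box a b p * norm w"
        by (simp add: M mult.commute)
    qed
  qed
  have "\<exists>f. harmonic_on f (ball 0 1) \<and> (\<forall>z\<in>ball 0 1. a $ j < f z \<and> f z < b $ j) \<and> f 0 = p $ j
     \<and> (f has_derivative (\<lambda>w. ?A j * Re w)) (at 0)" for j
    using harmonic_strip_extremal[OF p[of j]] by metis
  then obtain f :: "'n \<Rightarrow> complex \<Rightarrow> real" where f: "\<And>j. harmonic_on (f j) (ball 0 1)"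
    "\<And>j z. z \<in> ball 0 1 \<Longrightarrow> a $ j < f j z \<and> f j z < b $ j" "\<And>j. f j 0 = p $ j"
    "\<And>j. (f j has_derivative (\<lambda>w. ?A j * Re w)) (at 0)"
    by metis
  \<comment> \<open>Every component has its gradient at 0 along the real axis, so all of them attain
    their bounds in the same direction.\<close>
  define F where "F z = (\<chi> j. f j z)" for z
  have F: "F \<in> disc_box_maps a b p"
    using f by (auto simp: disc_box_maps_def harmonic_map_on_def F_def mem_box_cart vec_eq_iff)
  have dF: "(F has_derivative (\<lambda>w. \<chi> j. ?A j * Re w)) (at 0)"
    using f(4) by (intro has_derivative_vec_lambda) (simp add: F_def)
  \<comment> \<open>Evaluating the differential at the unit vector \<open>1\<close> bounds its
    operator norm below by \<open>M_box a b p\<close>.\<close>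
  have "norm (\<chi> j. ?A j * Re 1) \<le> onorm (frechet_derivative F (at 0)) * norm (1::complex)"
    unfolding frechet_derivative_at[OF dF, symmetric]
    using onorm[OF has_derivative_bounded_linear[OF dF], of 1] .
  then have "onorm (frechet_derivative F (at 0)) = M_box a b p"
    using upper[OF F] M by simp
  then have "(SUP F \<in> disc_box_maps a b p. onorm (frechet_derivative F (at 0))) = M_box a b p"
    using upper F by (intro cSup_eq_maximum) (metis imageI, auto)
  then show ?thesis using upper by blast
qed

end
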